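(* For $-1<m<0$ and for every $a\in\mathbb{R}$, the boundary value problem $$f'''+\frac{m+1}{2}ff''-mf'^2=0 \text{ on } [0,\infty),\qquad f(0)=a,\quad f'(0)=-1,\quad f'(\infty)=0$$ admits a convex solution.
   Context: A solution is a three times differentiable function $f:[0,\infty)\to\mathbb{R}$ satisfying the equation on $[0,\infty)$ and the boundary conditions, where $f'(\infty):=\lim_{t\to\infty}f'(t)$. A convex solution is a solution that is convex on all of $[0,\infty)$. *)

theory Defs
  imports "HOL-Analysis.Analysis"
begin

text \<open>
  A function on $[0,\infty)$ is represented by a total function whose values on the negative
  half-line are irrelevant: all derivatives are taken within \<open>{0..}\<close>, hence one-sided at \<open>0\<close>.
  Such derivatives are unique, so \<open>f1\<close>, \<open>f2\<close>, \<open>f3\<close> are determined on \<open>{0..}\<close> by \<open>f\<close>; their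
  existence expresses that \<open>f\<close> is three times differentiable (\<open>f3\<close> need not be assumed continuous).
\<close>

definition bvp_solution :: "real \<Rightarrow> real \<Rightarrow> real \<Rightarrow> (real \<Rightarrow> real) \<Rightarrow> bool" where
  "bvp_solution m a b f \<longleftrightarrow>
    (\<exists>f1 f2 f3.
      (\<forall>t\<ge>0. (f has_real_derivative f1 t) (at t within {0..})) \<and>
      (\<forall>t\<ge>0. (f1 has_real_derivative f2 t) (at t within {0..})) \<and>
      (\<forall>t\<ge>0. (f2 has_real_derivative f3 t) (at t within {0..})) \<and>
      (\<forall>t\<ge>0. f3 t + (m + 1) / 2 * f t * f2 t - m * (f1 t)\<^sup>2 = 0) \<and>
      f 0 = a \<and> f1 0 = b \<and> (f1 \<longlongrightarrow> 0) at_top)"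

definition convex_bvp_solution :: "real \<Rightarrow> real \<Rightarrow> real \<Rightarrow> (real \<Rightarrow> real) \<Rightarrow> bool" where
  "convex_bvp_solution m a b f \<longleftrightarrow> bvp_solution m a b f \<and> convex_on {0..} f"

end

theory Submission
  imports Defs
begin

text \<open>
  Shooting in \<open>\<alpha> = f''(0)\<close>. Truncating \<open>f'\<close> to \<open>[-2, 2]\<close> gives a flow that exists for all times and
  depends continuously on \<open>\<alpha>\<close>. The set of \<open>\<alpha>\<close> for which \<open>f''\<close> becomes negative while \<open>f' < 0\<close>, and the
  set of \<open>\<alpha>\<close> for which \<open>f'\<close> becomes positive while \<open>f'' > 0\<close>, are open, disjoint and nonempty; as the
  line is connected, some \<open>\<alpha>\<close> lies in neither. Since \<open>f'\<close> and \<open>f''\<close> cannot vanish simultaneously, and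
  \<open>f''' = m f'\<^sup>2 < 0\<close> where \<open>f'' = 0\<close>, this \<open>\<alpha>\<close> yields \<open>-1 \<le> f' < 0 < f''\<close> for all times, so that the
  truncation is inactive and \<open>f\<close> is convex. A limit \<open>l < 0\<close> of \<open>f'\<close> is incompatible with \<open>f'' > 0\<close>.
\<close>

section \<open>Linear-growth vector fields on the half-line\<close>

lemma integral_has_vector_derivative_atLeast:
  fixes \<phi> :: "real \<Rightarrow> 'a::banach"
  assumes "continuous_on {0..} \<phi>" "t \<ge> 0"
  shows "((\<lambda>u. integral {0..u} \<phi>) has_vector_derivative \<phi> t) (at t within {0..})"
proof -
  \<comment> \<open>The interval reaches past \<open>t\<close>, so that it agrees with the half-line
    in a neighbourhood of \<open>t\<close>.\<close>
  have "((\<lambda>u. integral {0..u} \<phi>) has_vector_derivative \<phi> t) (at t within {0..t + 1})"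
    using assms by (intro integral_has_vector_derivative) (auto intro: continuous_on_subset)
  moreover have "at t within {0..t + 1} = at t within {0..}"
    by (rule at_within_nhd[where S = "{..<t + 1}"]) auto
  ultimately show ?thesis by simp
qed

text \<open>The fundamental theorem for the gauge integral holds for every derivative, continuous or
  not. The differential inequalities below are all integrated through this lemma, applied to a
  suitable auxiliary function.\<close>

lemma has_real_derivative_nonneg_imp_le:
  fixes f f' :: "real \<Rightarrow> real"
  assumes "0 \<le> s" "s \<le> t"
    and "\<And>u. s \<le> u \<Longrightarrow> u \<le> t \<Longrightarrow> (f has_real_derivative f' u) (at u within {0..})"
    and "\<And>u. s \<le> u \<Longrightarrow> u \<le> t \<Longrightarrow> f' u \<ge> 0"
  shows "f s \<le> f t"
proof -
  have "(f' has_integral f t - f s) {s..t}"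
  proof (rule fundamental_theorem_of_calculus)
    show "(f has_vector_derivative f' u) (at u within {s..t})" if "u \<in> {s..t}" for u
      unfolding has_real_derivative_iff_has_vector_derivative[symmetric]
      using that assms(1) by (intro DERIV_subset[OF assms(3)]) auto
  qed (rule assms)
  then have "0 \<le> f t - f s"
    by (rule has_integral_nonneg) (use assms in auto)
  then show ?thesis by simp
qed

lemma abs_diff_le_of_derivative_bound:
  fixes f f' :: "real \<Rightarrow> real"
  assumes "t \<ge> 0"
    and deriv: "\<And>u. 0 \<le> u \<Longrightarrow> (f has_real_derivative f' u) (at u within {0..})"
    and bound: "\<And>u. \<bar>f' u\<bar> \<le> B"
  shows "\<bar>f t - f 0\<bar> \<le> B * t"
proof -
  have "f 0 + B * 0 \<le> f t + B * t"
  proof (rule has_real_derivative_nonneg_imp_le[OF order_refl \<open>t \<ge> 0\<close>,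
        where f = "\<lambda>t. f t + B * t" and f' = "\<lambda>u. f' u + B"])
    show "((\<lambda>t. f t + B * t) has_real_derivative f' u + B) (at u within {0..})"
      if "0 \<le> u" for u
      by (rule derivative_eq_intros deriv that refl | simp)+
    show "0 \<le> f' u + B" for u using bound[of u] by linarith
  qed
  moreover have "B * 0 - f 0 \<le> B * t - f t"
  proof (rule has_real_derivative_nonneg_imp_le[OF order_refl \<open>t \<ge> 0\<close>,
        where f = "\<lambda>t. B * t - f t" and f' = "\<lambda>u. B - f' u"])
    show "((\<lambda>t. B * t - f t) has_real_derivative B - f' u) (at u within {0..})"
      if "0 \<le> u" for u
      by (rule derivative_eq_intros deriv that refl | simp)+
    show "0 \<le> B - f' u" for u using bound[of u] by linarith
  qed
  ultimately show ?thesis by linarith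
qed

text \<open>A nondecreasing derivative keeps the graph above each of its tangents; averaging the
  tangent at the intermediate point \<open>s\<close> over both endpoints gives convexity.\<close>

lemma convex_on_nondecreasing_derivative:
  fixes f f' :: "real \<Rightarrow> real"
  assumes deriv: "\<And>u. 0 \<le> u \<Longrightarrow> (f has_real_derivative f' u) (at u within {0..})"
    and mono: "\<And>u v. 0 \<le> u \<Longrightarrow> u \<le> v \<Longrightarrow> f' u \<le> f' v"
  shows "convex_on {0..} f"
proof -
  have tangent: "f s + f' s * (v - s) \<le> f v" if "s \<ge> 0" "v \<ge> 0" for s v
  proof (cases "s \<le> v")
    case True
    have "f s - f' s * s \<le> f v - f' s * v"
    proof (rule has_real_derivative_nonneg_imp_le[OF \<open>s \<ge> 0\<close> True,
          where f = "\<lambda>r. f r - f' s * r" and f' = "\<lambda>r. f' r - f' s"])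
      show "((\<lambda>r. f r - f' s * r) has_real_derivative f' u - f' s) (at u within {0..})"
        if "s \<le> u" for u
        using that \<open>s \<ge> 0\<close> by (auto intro!: derivative_eq_intros deriv)
    qed (use mono \<open>s \<ge> 0\<close> in auto)
    then show ?thesis by (simp add: algebra_simps)
  next
    case False
    have "f' s * v - f v \<le> f' s * s - f s"
    proof (rule has_real_derivative_nonneg_imp_le[OF \<open>v \<ge> 0\<close>,
          where f = "\<lambda>r. f' s * r - f r" and f' = "\<lambda>r. f' s - f' r"])
      show "((\<lambda>r. f' s * r - f r) has_real_derivative f' s - f' u) (at u within {0..})"
        if "v \<le> u" for u
        using that \<open>v \<ge> 0\<close> by (auto intro!: derivative_eq_intros deriv)
    qed (use mono \<open>v \<ge> 0\<close> False in auto)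
    then show ?thesis by (simp add: algebra_simps)
  qed
  show ?thesis
  proof (rule convex_onI)
    fix t u v :: real
    assume t: "0 < t" "t < 1" and uv: "u \<in> {0..}" "v \<in> {0..}"
    define s where "s = (1 - t) * u + t * v"
    have s: "s \<ge> 0" using t uv by (simp add: s_def)
    \<comment> \<open>The slope terms cancel, since \<open>s\<close> is the weighted mean of
      \<open>u\<close> and \<open>v\<close>.\<close>
    have "f s = (1 - t) * (f s + f' s * (u - s)) + t * (f s + f' s * (v - s))"
      unfolding s_def by (simp add: algebra_simps)
    also have "\<dots> \<le> (1 - t) * f u + t * f v"
      using t uv s by (intro add_mono mult_left_mono tangent) auto
    finally show "f ((1 - t) *\<^sub>R u + t *\<^sub>R v) \<le> (1 - t) * f u + t * f v"
      by (simp add: s_def)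
  qed simp
qed

section \<open>Global existence and Lipschitz dependence on initial values by a weighted
  contraction\<close>

locale lipschitz_ode =
  fixes F :: "real \<Rightarrow> 'a::banach \<Rightarrow> 'a" and L \<Lambda> :: "real \<Rightarrow> real"
  assumes continuous_F: "continuous_on ({0..} \<times> UNIV) (\<lambda>(t, x). F t x)"
    and lipschitz_F: "\<And>t x y. t \<ge> 0 \<Longrightarrow> norm (F t x - F t y) \<le> L t * norm (x - y)"
    and F_zero: "\<And>t. t \<ge> 0 \<Longrightarrow> norm (F t 0) \<le> L t"
    and deriv_\<Lambda>: "\<And>t. t \<ge> 0 \<Longrightarrow> (\<Lambda> has_real_derivative L t) (at t within {0..})"
    and \<Lambda>_0: "\<Lambda> 0 = 0"
begin

lemma L_nonneg: "t \<ge> 0 \<Longrightarrow> L t \<ge> 0"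
  using F_zero[of t] norm_ge_zero[of "F t 0"] by linarith

lemma \<Lambda>_mono:
  assumes "0 \<le> s" "s \<le> t"
  shows "\<Lambda> s \<le> \<Lambda> t"
  by (rule has_real_derivative_nonneg_imp_le[OF assms, where f' = L])
     (use assms in \<open>auto intro!: deriv_\<Lambda> L_nonneg\<close>)

lemma \<Lambda>_nonneg: "t \<ge> 0 \<Longrightarrow> \<Lambda> t \<ge> 0"
  using \<Lambda>_mono[of 0 t] \<Lambda>_0 by simp

lemma continuous_\<Lambda>: "continuous_on {0..} \<Lambda>"
  using deriv_\<Lambda> by (auto simp: continuous_on_eq_continuous_within intro!: DERIV_continuous)

lemma continuous_F_comp:
  assumes "continuous_on {0..} g"
  shows "continuous_on {0..} (\<lambda>s. F s (g s))"
proof -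
  have "continuous_on {0..} (\<lambda>s. (s, g s))"
    using assms by (intro continuous_intros)
  then show ?thesis
    using continuous_on_compose2[OF continuous_F, of "{0..}" "\<lambda>s. (s, g s)"] by auto
qed

text \<open>The bound on the integrand is the derivative of
  \<open>d / 2 * exp (2 * \<Lambda> s)\<close>, because \<open>\<Lambda>' = L\<close>. The factor
  1/2 gained here becomes the contraction constant.\<close>

lemma norm_integral_le:
  assumes "continuous_on {0..} \<phi>" "t \<ge> 0"
    and "\<And>s. s \<ge> 0 \<Longrightarrow> norm (\<phi> s) \<le> d * (L s * exp (2 * \<Lambda> s))"
  shows "norm (integral {0..t} (\<phi> :: real \<Rightarrow> 'a)) \<le> d / 2 * (exp (2 * \<Lambda> t) - 1)"
proof -
  have *: "((\<lambda>s. d * (L s * exp (2 * \<Lambda> s))) has_integral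
      d / 2 * exp (2 * \<Lambda> t) - d / 2 * exp (2 * \<Lambda> 0)) {0..t}"
    using assms(2)
    by (intro fundamental_theorem_of_calculus)
       (auto simp flip: has_real_derivative_iff_has_vector_derivative
         intro!: derivative_eq_intros DERIV_subset[OF deriv_\<Lambda>])
  have "norm (integral {0..t} \<phi>) \<le> integral {0..t} (\<lambda>s. d * (L s * exp (2 * \<Lambda> s)))"
  proof (rule integral_norm_bound_integral)
    show "\<phi> integrable_on {0..t}"
      using assms(1) by (intro integrable_continuous_interval) (auto elim: continuous_on_subset)
    show "(\<lambda>s. d * (L s * exp (2 * \<Lambda> s))) integrable_on {0..t}"
      using * by (rule has_integral_integrable)
  qed (use assms(3) in auto)
  also have "\<dots> = d / 2 * (exp (2 * \<Lambda> t) - 1)"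
    using integral_unique[OF *] by (simp add: \<Lambda>_0 algebra_simps)
  finally show ?thesis .
qed

text \<open>The Picard operator acting on \<open>h t = exp (- 2 \<Lambda> t) X t\<close>: with this weight it maps bounded functions
  on the whole half-line to bounded functions and contracts by the factor \<open>1/2\<close>.\<close>

definition picard :: "'a \<Rightarrow> (real \<Rightarrow> 'a) \<Rightarrow> real \<Rightarrow> 'a" where
  "picard \<xi> h t = exp (- 2 * \<Lambda> t) *\<^sub>R
     (\<xi> + integral {0..t} (\<lambda>s. F s (exp (2 * \<Lambda> s) *\<^sub>R h s)))"

lemma continuous_picard_integrand:
  "continuous_on {0..} (\<lambda>s. F s (exp (2 * \<Lambda> s) *\<^sub>R apply_bcontfun h s))"
  by (intro continuous_F_comp continuous_intros continuous_\<Lambda>) auto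

text \<open>Bounded continuous functions live on the whole line here; \<open>max 0 t\<close> extends
  the operator constantly to negative times.\<close>

lemma picard_bcontfun: "(\<lambda>t. picard \<xi> (apply_bcontfun h) (max 0 t)) \<in> bcontfun"
proof (rule bcontfun_normI)
  have "continuous_on {0..} (\<lambda>t. integral {0..t} (\<lambda>s. F s (exp (2 * \<Lambda> s) *\<^sub>R apply_bcontfun h s)))"
    unfolding continuous_on_eq_continuous_within
    using integral_has_vector_derivative_atLeast[OF continuous_picard_integrand]
    by (auto intro: has_vector_derivative_continuous)
  then have "continuous_on {0..} (picard \<xi> (apply_bcontfun h))"
    unfolding picard_def by (intro continuous_intros continuous_\<Lambda>)
  then show "continuous_on UNIV (\<lambda>t. picard \<xi> (apply_bcontfun h) (max 0 t))"
    by (rule continuous_on_compose2) (auto intro!: continuous_intros)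
next
  fix t :: real
  define \<tau> where "\<tau> = max 0 t"
  have \<tau>: "\<tau> \<ge> 0" by (simp add: \<tau>_def)
  \<comment> \<open>Compare with \<open>F s 0\<close>; as
    \<open>exp (2 * \<Lambda> s) \<ge> 1\<close>, the weight absorbs the inhomogeneous term
    too.\<close>
  have bound: "norm (F s (exp (2 * \<Lambda> s) *\<^sub>R apply_bcontfun h s)) \<le> (1 + norm h) * (L s * exp (2 * \<Lambda> s))"
    if "s \<ge> 0" for s
  proof -
    have "norm (F s (exp (2 * \<Lambda> s) *\<^sub>R apply_bcontfun h s))
        \<le> norm (F s 0) + norm (F s (exp (2 * \<Lambda> s) *\<^sub>R apply_bcontfun h s) - F s 0)"
      by (metis add.commute norm_triangle_sub)
    also have "\<dots> \<le> L s + L s * norm (exp (2 * \<Lambda> s) *\<^sub>R apply_bcontfun h s)"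
      using F_zero[OF that] lipschitz_F[OF that, of "exp (2 * \<Lambda> s) *\<^sub>R apply_bcontfun h s" 0]
      by (intro add_mono) auto
    also have "\<dots> \<le> L s * exp (2 * \<Lambda> s) + L s * (exp (2 * \<Lambda> s) * norm h)"
      using L_nonneg[OF that] \<Lambda>_nonneg[OF that]
      by (intro add_mono mult_left_mono)
         (auto simp: mult_le_cancel_left1 intro!: norm_bounded mult_left_mono)
    finally show ?thesis by (simp add: algebra_simps)
  qed
  have "norm (picard \<xi> (apply_bcontfun h) \<tau>)
      \<le> exp (- 2 * \<Lambda> \<tau>) * (norm \<xi> + (1 + norm h) / 2 * (exp (2 * \<Lambda> \<tau>) - 1))"
    unfolding picard_def norm_scaleR
    by (intro mult_mono norm_triangle_le add_left_mono
        norm_integral_le[OF continuous_picard_integrand \<tau> bound]) auto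
  also have "\<dots> = exp (- 2 * \<Lambda> \<tau>) * norm \<xi> + (1 + norm h) / 2 * (1 - exp (- 2 * \<Lambda> \<tau>))"
    by (simp add: algebra_simps flip: exp_add)
  also have "\<dots> \<le> 1 * norm \<xi> + (1 + norm h) / 2 * 1"
    using \<Lambda>_nonneg[OF \<tau>] by (intro add_mono mult_mono) auto
  finally show "norm (picard \<xi> (apply_bcontfun h) (max 0 t)) \<le> norm \<xi> + (1 + norm h) / 2"
    by (simp add: \<tau>_def)
qed

lemma picard_contraction:
  assumes "t \<ge> 0"
  shows "norm (picard \<xi> (apply_bcontfun g) t - picard \<eta> (apply_bcontfun h) t)
    \<le> norm (\<xi> - \<eta>) + dist g h / 2"
proof -
  let ?f = "\<lambda>h s. F s (exp (2 * \<Lambda> s) *\<^sub>R apply_bcontfun h s)"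
  have bound: "norm (?f g s - ?f h s) \<le> dist g h * (L s * exp (2 * \<Lambda> s))" if "s \<ge> 0" for s
  proof -
    have "norm (?f g s - ?f h s) \<le> L s * norm (exp (2 * \<Lambda> s) *\<^sub>R (apply_bcontfun g s - apply_bcontfun h s))"
      using lipschitz_F[OF that] by (metis scaleR_diff_right)
    also have "\<dots> \<le> L s * (exp (2 * \<Lambda> s) * dist g h)"
      using L_nonneg[OF that] dist_bounded[of g s h]
      by (intro mult_left_mono) (auto simp: dist_norm)
    finally show ?thesis by (simp add: algebra_simps)
  qed
  have int: "?f h integrable_on {0..t}" for h
    by (intro integrable_continuous_interval continuous_on_subset[OF continuous_picard_integrand]) auto
  have "picard \<xi> (apply_bcontfun g) t - picard \<eta> (apply_bcontfun h) t
      = exp (- 2 * \<Lambda> t) *\<^sub>R ((\<xi> - \<eta>) + integral {0..t} (\<lambda>s. ?f g s - ?f h s))"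
    unfolding picard_def Henstock_Kurzweil_Integration.integral_diff[OF int int]
    by (simp add: scaleR_right_diff_distrib scaleR_right_distrib)
  also have "norm \<dots> \<le> exp (- 2 * \<Lambda> t) * (norm (\<xi> - \<eta>) + dist g h / 2 * (exp (2 * \<Lambda> t) - 1))"
    unfolding norm_scaleR
    by (intro mult_mono norm_triangle_le add_left_mono norm_integral_le[OF _ assms bound]
        continuous_on_diff continuous_picard_integrand) auto
  also have "\<dots> = exp (- 2 * \<Lambda> t) * norm (\<xi> - \<eta>) + dist g h / 2 * (1 - exp (- 2 * \<Lambda> t))"
    by (simp add: algebra_simps flip: exp_add)
  also have "\<dots> \<le> 1 * norm (\<xi> - \<eta>) + dist g h / 2 * 1"
    using \<Lambda>_nonneg[OF assms] by (intro add_mono mult_mono) auto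
  finally show ?thesis by simp
qed

lemma solution_family:
  obtains X :: "'a \<Rightarrow> real \<Rightarrow> 'a"
  where "\<And>\<xi>. X \<xi> 0 = \<xi>"
    and "\<And>\<xi> t. t \<ge> 0 \<Longrightarrow> (X \<xi> has_vector_derivative F t (X \<xi> t)) (at t within {0..})"
    and "\<And>\<xi> \<eta> t. t \<ge> 0 \<Longrightarrow> norm (X \<xi> t - X \<eta> t) \<le> 2 * norm (\<xi> - \<eta>) * exp (2 * \<Lambda> t)"
proof -
  define P where "P \<xi> h = Bcontfun (\<lambda>t. picard \<xi> (apply_bcontfun h) (max 0 t))" for \<xi> h
  have P: "apply_bcontfun (P \<xi> h) t = picard \<xi> (apply_bcontfun h) (max 0 t)" for \<xi> h t
    unfolding P_def using picard_bcontfun by (simp add: Bcontfun_inverse)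
  have dist_P: "dist (P \<xi> g) (P \<eta> h) \<le> norm (\<xi> - \<eta>) + dist g h / 2" for \<xi> \<eta> g h
    using picard_contraction by (intro dist_bound) (auto simp: P dist_norm)
  have "\<exists>!h. P \<xi> h = h" for \<xi>
    using dist_P[of \<xi> _ \<xi>] by (intro banach_fix_type[where c = "1/2"]) auto
  then obtain H where H: "\<And>\<xi>. P \<xi> (H \<xi>) = H \<xi>" by metis
  define X where "X \<xi> t = exp (2 * \<Lambda> t) *\<^sub>R apply_bcontfun (H \<xi>) t" for \<xi> t
  have X: "X \<xi> t = \<xi> + integral {0..t} (\<lambda>s. F s (X \<xi> s))" if "t \<ge> 0" for \<xi> t
    using P[of \<xi> "H \<xi>" t] that
    by (simp add: H X_def picard_def flip: exp_add)
  show thesis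
  proof
    show "X \<xi> 0 = \<xi>" for \<xi>
      using X[of 0 \<xi>] by simp
    show "(X \<xi> has_vector_derivative F t (X \<xi> t)) (at t within {0..})" if "t \<ge> 0" for \<xi> t
    proof (rule has_vector_derivative_transform)
      show "((\<lambda>t. \<xi> + integral {0..t} (\<lambda>s. F s (X \<xi> s))) has_vector_derivative F t (X \<xi> t))
          (at t within {0..})"
        using integral_has_vector_derivative_atLeast[OF continuous_picard_integrand that]
        unfolding X_def by (auto intro!: derivative_eq_intros)
    qed (use X that in auto)
    show "norm (X \<xi> t - X \<eta> t) \<le> 2 * norm (\<xi> - \<eta>) * exp (2 * \<Lambda> t)" if "t \<ge> 0" for \<xi> \<eta> t
    proof -
      \<comment> \<open>For the fixed points the estimate bounds the distance by
        \<open>norm (\<xi> - \<eta>)\<close> plus half of itself; the half is absorbed on the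
        left.\<close>
      have "dist (H \<xi>) (H \<eta>) \<le> 2 * norm (\<xi> - \<eta>)"
        using dist_P[of \<xi> "H \<xi>" \<eta> "H \<eta>"] by (simp add: H)
      then have "norm (apply_bcontfun (H \<xi>) t - apply_bcontfun (H \<eta>) t) \<le> 2 * norm (\<xi> - \<eta>)"
        using dist_bounded[of "H \<xi>" t "H \<eta>"] by (simp add: dist_norm)
      then show ?thesis
        by (simp add: X_def mult.commute flip: scaleR_diff_right)
    qed
  qed
qed

end

section \<open>The truncated equation\<close>

definition trunc :: "real \<Rightarrow> real \<Rightarrow> real" where
  "trunc r v = max (- r) (min r v)"

lemma trunc_eq: "\<bar>v\<bar> \<le> r \<Longrightarrow> trunc r v = v"
  by (auto simp: trunc_def)

lemma abs_trunc_le: "r \<ge> 0 \<Longrightarrow> \<bar>trunc r v\<bar> \<le> r"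
  by (auto simp: trunc_def)

lemma abs_trunc_diff_le: "\<bar>trunc r v - trunc r w\<bar> \<le> \<bar>v - w\<bar>"
  by (auto simp: trunc_def max_def min_def)

text \<open>Here \<open>x\<close>, \<open>y\<close>, \<open>z\<close> stand for \<open>f\<close>,
  \<open>f'\<close>, \<open>f''\<close>. The last equation differentiates
  \<open>z + c x trunc 2 y\<close> and not \<open>z\<close>, because \<open>z\<close> may fail to be
  differentiable where \<open>y\<close> meets the kinks of the truncation.\<close>

definition truncated_flow ::
    "real \<Rightarrow> real \<Rightarrow> (real \<Rightarrow> real) \<Rightarrow> (real \<Rightarrow> real) \<Rightarrow> (real \<Rightarrow> real) \<Rightarrow> bool" where
  "truncated_flow m a x y z \<longleftrightarrow> x 0 = a \<and> y 0 = -1 \<and>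
    (\<forall>t\<ge>0. (x has_real_derivative trunc 2 (y t)) (at t within {0..}) \<and>
      (y has_real_derivative z t) (at t within {0..}) \<and>
      ((\<lambda>t. z t + (m + 1) / 2 * x t * trunc 2 (y t)) has_real_derivative
        (3 * m + 1) / 2 * (trunc 2 (y t))\<^sup>2) (at t within {0..}))"

text \<open>The third coordinate is \<open>p = f'' + c f f'\<close> with \<open>c = (m + 1) / 2\<close>, for which the equation reads
  \<open>p' = (c + m) f'\<^sup>2\<close>; this choice makes the Lipschitz constant of the truncated field grow only
  linearly in time. The truncation of the first coordinate is never active, since \<open>\<bar>x'\<bar> \<le> 2\<close>.\<close>

definition truncated_field :: "real \<Rightarrow> real \<Rightarrow> real \<Rightarrow> real \<times> real \<times> real \<Rightarrow> real \<times> real \<times> real" where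
  "truncated_field m a t X =
    (trunc 2 (fst (snd X)),
     snd (snd X) - (m + 1) / 2 * trunc (\<bar>a\<bar> + 2 * t) (fst X) * trunc 2 (fst (snd X)),
     (3 * m + 1) / 2 * (trunc 2 (fst (snd X)))\<^sup>2)"

lemma continuous_truncated_field: "continuous_on S (\<lambda>(t, X). truncated_field m a t X)"
  unfolding truncated_field_def trunc_def split_beta by (intro continuous_intros)

lemma abs_le_norm_triple:
  fixes X :: "real \<times> real \<times> real"
  shows "\<bar>fst X\<bar> \<le> norm X" "\<bar>fst (snd X)\<bar> \<le> norm X" "\<bar>snd (snd X)\<bar> \<le> norm X"
  using norm_fst_le[of "fst X" "snd X"] norm_snd_le[of "snd X" "fst X"]
    norm_fst_le[of "fst (snd X)" "snd (snd X)"] norm_snd_le[of "snd (snd X)" "fst (snd X)"]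
  by simp_all

lemma norm_triple_le: "norm (u, v, w) \<le> \<bar>u\<bar> + \<bar>v\<bar> + \<bar>w\<bar>" for u v w :: real
  using norm_Pair_le[of u "(v, w)"] norm_Pair_le[of v w] by simp

text \<open>Truncation bounds the factors of the product by \<open>R = \<bar>a\<bar> + 2 * t\<close>
  and 2, so the product is Lipschitz with constant \<open>R + 2\<close> and the square with constant
  4. Both coefficients have modulus at most 1, and the two linear terms add 2, in total
  \<open>R + 8\<close>.\<close>

lemma lipschitz_truncated_field:
  assumes m: "-1 < m" "m < 0" and t: "t \<ge> 0"
  shows "norm (truncated_field m a t X - truncated_field m a t Y)
    \<le> (8 + \<bar>a\<bar> + 2 * t) * norm (X - Y)"
proof -
  obtain u v w where X: "X = (u, v, w)" by (cases X)
  obtain u' v' w' where Y: "Y = (u', v', w')" by (cases Y)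
  define R where "R = \<bar>a\<bar> + 2 * t"
  have R: "R \<ge> 0" using t by (simp add: R_def)
  let ?v = "trunc 2 v" and ?v' = "trunc 2 v'" and ?u = "trunc R u" and ?u' = "trunc R u'"
  define N where "N = norm (X - Y)"
  have N: "\<bar>u - u'\<bar> \<le> N" "\<bar>v - v'\<bar> \<le> N" "\<bar>w - w'\<bar> \<le> N"
    using abs_le_norm_triple[of "X - Y"] by (simp_all add: X Y N_def)
  have dv: "\<bar>?v - ?v'\<bar> \<le> N" and du: "\<bar>?u - ?u'\<bar> \<le> N"
    using abs_trunc_diff_le[of 2 v v'] abs_trunc_diff_le[of R u u'] N by linarith+
  have "?u * ?v - ?u' * ?v' = ?u * (?v - ?v') + (?u - ?u') * ?v'"
    by (simp add: algebra_simps)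
  also have "\<bar>\<dots>\<bar> \<le> \<bar>?u\<bar> * \<bar>?v - ?v'\<bar> + \<bar>?u - ?u'\<bar> * \<bar>?v'\<bar>"
    by (metis abs_mult abs_triangle_ineq)
  also have "\<dots> \<le> R * N + N * 2"
    using dv du R abs_trunc_le[of R u] abs_trunc_le[of 2 v'] by (intro add_mono mult_mono) auto
  finally have uv: "\<bar>?u * ?v - ?u' * ?v'\<bar> \<le> (R + 2) * N" by (simp add: algebra_simps)
  have "\<bar>(m + 1) / 2\<bar> * \<bar>?u * ?v - ?u' * ?v'\<bar> \<le> 1 * ((R + 2) * N)"
    using m uv by (intro mult_mono) auto
  then have uv2: "\<bar>(m + 1) / 2 * (?u * ?v - ?u' * ?v')\<bar> \<le> (R + 2) * N"
    unfolding abs_mult by simp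
  have "?v\<^sup>2 - ?v'\<^sup>2 = (?v + ?v') * (?v - ?v')" by (simp add: algebra_simps power2_eq_square)
  also have "\<bar>\<dots>\<bar> \<le> 4 * N"
    unfolding abs_mult
  proof (intro mult_mono dv)
    show "\<bar>?v + ?v'\<bar> \<le> 4"
      using abs_trunc_le[of 2 v] abs_trunc_le[of 2 v'] by linarith
  qed auto
  finally have "\<bar>(3 * m + 1) / 2\<bar> * \<bar>?v\<^sup>2 - ?v'\<^sup>2\<bar> \<le> 1 * (4 * N)"
    using m by (intro mult_mono) auto
  then have vv: "\<bar>(3 * m + 1) / 2 * (?v\<^sup>2 - ?v'\<^sup>2)\<bar> \<le> 4 * N"
    unfolding abs_mult by simp
  have "norm (truncated_field m a t X - truncated_field m a t Y) =
      norm (?v - ?v', (w - w') - (m + 1) / 2 * (?u * ?v - ?u' * ?v'), (3 * m + 1) / 2 * (?v\<^sup>2 - ?v'\<^sup>2))"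
    unfolding X Y truncated_field_def fst_conv snd_conv diff_Pair R_def[symmetric]
    by (intro arg_cong[where f = norm] prod_eqI) (simp_all add: right_diff_distrib mult.assoc)
  also have "\<dots> \<le> N + (N + (R + 2) * N) + 4 * N"
    by (intro order_trans[OF norm_triple_le] add_mono dv vv
        order_trans[OF abs_triangle_ineq4 add_mono[OF N(3) uv2]])
  finally show ?thesis by (simp add: R_def N_def algebra_simps)
qed

lemma truncated_flow_family:
  assumes m: "-1 < m" "m < 0"
  obtains x y z :: "real \<Rightarrow> real \<Rightarrow> real" and E :: "real \<Rightarrow> real"
  where "\<And>\<alpha>. truncated_flow m a (x \<alpha>) (y \<alpha>) (z \<alpha>)" and "\<And>\<alpha>. z \<alpha> 0 = \<alpha>"
    and "\<And>\<alpha> \<beta> t. t \<ge> 0 \<Longrightarrow> \<bar>y \<alpha> t - y \<beta> t\<bar> \<le> E t * \<bar>\<alpha> - \<beta>\<bar>"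
    and "\<And>\<alpha> \<beta> t. t \<ge> 0 \<Longrightarrow> \<bar>z \<alpha> t - z \<beta> t\<bar> \<le> E t * \<bar>\<alpha> - \<beta>\<bar>"
    and "\<And>s t. 0 \<le> s \<Longrightarrow> s \<le> t \<Longrightarrow> E s \<le> E t"
proof -
  define L where "L t = 8 + \<bar>a\<bar> + 2 * t" for t
  define \<Lambda> where "\<Lambda> t = (8 + \<bar>a\<bar>) * t + t\<^sup>2" for t
  interpret lipschitz_ode "truncated_field m a" L \<Lambda>
  proof
    show "continuous_on ({0..} \<times> UNIV) (\<lambda>(t, X). truncated_field m a t X)"
      by (rule continuous_truncated_field)
    show "norm (truncated_field m a t X - truncated_field m a t Y) \<le> L t * norm (X - Y)"
      if "t \<ge> 0" for t X Y
      using lipschitz_truncated_field[OF m that] by (simp add: L_def)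
    show "norm (truncated_field m a t 0) \<le> L t" if "t \<ge> 0" for t
      using that by (simp add: truncated_field_def trunc_def L_def)
    show "(\<Lambda> has_real_derivative L t) (at t within {0..})" if "t \<ge> 0" for t
      unfolding \<Lambda>_def L_def by (auto intro!: derivative_eq_intros)
    show "\<Lambda> 0 = 0" by (simp add: \<Lambda>_def)
  qed
  obtain X :: "real \<times> real \<times> real \<Rightarrow> real \<Rightarrow> real \<times> real \<times> real"
    where X0: "\<And>\<xi>. X \<xi> 0 = \<xi>"
    and dX: "\<And>\<xi> t. t \<ge> 0 \<Longrightarrow> (X \<xi> has_vector_derivative truncated_field m a t (X \<xi> t)) (at t within {0..})"
    and X_dep: "\<And>\<xi> \<eta> t. t \<ge> 0 \<Longrightarrow> norm (X \<xi> t - X \<eta> t) \<le> 2 * norm (\<xi> - \<eta>) * exp (2 * \<Lambda> t)"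
    using solution_family by metis
  define c where "c = (m + 1) / 2"
  \<comment> \<open>The third entry is the value of \<open>f'' + c f f'\<close> at 0 when
    \<open>f'' = \<alpha>\<close>, \<open>f = a\<close> and \<open>f' = -1\<close>.\<close>
  define \<xi> where "\<xi> \<alpha> = (a, - 1 :: real, \<alpha> - c * a)" for \<alpha>
  define x where "x \<alpha> t = fst (X (\<xi> \<alpha>) t)" for \<alpha> t
  define y where "y \<alpha> t = fst (snd (X (\<xi> \<alpha>) t))" for \<alpha> t
  define p where "p \<alpha> t = snd (snd (X (\<xi> \<alpha>) t))" for \<alpha> t
  \<comment> \<open>Taking \<open>z\<close> as the second component of the field makes
    \<open>y' = z\<close> immediate; its dependence on \<open>\<alpha>\<close> then costs one more
    Lipschitz factor \<open>L t\<close>.\<close>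
  define z where "z \<alpha> t = fst (snd (truncated_field m a t (X (\<xi> \<alpha>) t)))" for \<alpha> t
  \<comment> \<open>The summand 1 lets the same factor bound \<open>y\<close> and
    \<open>z\<close>.\<close>
  define E where "E t = (1 + L t) * (2 * exp (2 * \<Lambda> t))" for t
  have dx: "(x \<alpha> has_real_derivative trunc 2 (y \<alpha> t)) (at t within {0..})"
    and dy: "(y \<alpha> has_real_derivative z \<alpha> t) (at t within {0..})"
    and dp: "(p \<alpha> has_real_derivative (3 * m + 1) / 2 * (trunc 2 (y \<alpha> t))\<^sup>2) (at t within {0..})"
    if "t \<ge> 0" for \<alpha> t
    using bounded_linear.has_vector_derivative[OF bounded_linear_fst dX[OF that, of "\<xi> \<alpha>"]]
      bounded_linear.has_vector_derivative[OF bounded_linear_fst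
        bounded_linear.has_vector_derivative[OF bounded_linear_snd dX[OF that, of "\<xi> \<alpha>"]]]
      bounded_linear.has_vector_derivative[OF bounded_linear_snd
        bounded_linear.has_vector_derivative[OF bounded_linear_snd dX[OF that, of "\<xi> \<alpha>"]]]
    unfolding x_def[abs_def] y_def[abs_def] z_def p_def[abs_def] has_real_derivative_iff_has_vector_derivative
    by (simp_all add: truncated_field_def)
  have x0: "x \<alpha> 0 = a" and y0: "y \<alpha> 0 = - 1" and p0: "p \<alpha> 0 = \<alpha> - c * a" for \<alpha>
    by (simp_all add: x_def y_def p_def X0 \<xi>_def)
  have x_bound: "\<bar>x \<alpha> t\<bar> \<le> \<bar>a\<bar> + 2 * t" if "t \<ge> 0" for \<alpha> t
    using abs_diff_le_of_derivative_bound[OF that dx abs_trunc_le, of \<alpha>] x0[of \<alpha>] by simp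
  have z: "z \<alpha> t + c * x \<alpha> t * trunc 2 (y \<alpha> t) = p \<alpha> t" if "t \<ge> 0" for \<alpha> t
    using trunc_eq[OF x_bound[OF that, of \<alpha>]] unfolding z_def truncated_field_def
    by (simp add: x_def y_def p_def c_def)
  have X_dep': "norm (X (\<xi> \<alpha>) t - X (\<xi> \<beta>) t) \<le> 2 * exp (2 * \<Lambda> t) * \<bar>\<alpha> - \<beta>\<bar>" if "t \<ge> 0" for \<alpha> \<beta> t
    using X_dep[OF that, of "\<xi> \<alpha>" "\<xi> \<beta>"] by (simp add: \<xi>_def norm_Pair mult_ac)
  show thesis
  proof
    show "truncated_flow m a (x \<alpha>) (y \<alpha>) (z \<alpha>)" for \<alpha>
    proof -
      have "((\<lambda>t. z \<alpha> t + (m + 1) / 2 * x \<alpha> t * trunc 2 (y \<alpha> t)) has_real_derivative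
        (3 * m + 1) / 2 * (trunc 2 (y \<alpha> t))\<^sup>2) (at t within {0..})" if "t \<ge> 0" for t
        using that z by (intro has_field_derivative_transform_within[OF dp zero_less_one]) (auto simp: c_def)
      then show ?thesis
        unfolding truncated_flow_def using x0 y0 dx dy by blast
    qed
    show "z \<alpha> 0 = \<alpha>" for \<alpha>
      using z[of 0 \<alpha>] by (simp add: x0 y0 p0 trunc_def)
    show "\<bar>y \<alpha> t - y \<beta> t\<bar> \<le> E t * \<bar>\<alpha> - \<beta>\<bar>" if "t \<ge> 0" for \<alpha> \<beta> t
    proof -
      have "\<bar>y \<alpha> t - y \<beta> t\<bar> \<le> 1 * (2 * exp (2 * \<Lambda> t)) * \<bar>\<alpha> - \<beta>\<bar>"
        using abs_le_norm_triple(2)[of "X (\<xi> \<alpha>) t - X (\<xi> \<beta>) t"] X_dep'[OF that, of \<alpha> \<beta>]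
        by (simp add: y_def)
      also have "\<dots> \<le> E t * \<bar>\<alpha> - \<beta>\<bar>"
        unfolding E_def using L_nonneg[OF that] by (intro mult_right_mono) auto
      finally show ?thesis .
    qed
    show "\<bar>z \<alpha> t - z \<beta> t\<bar> \<le> E t * \<bar>\<alpha> - \<beta>\<bar>" if "t \<ge> 0" for \<alpha> \<beta> t
    proof -
      have "\<bar>z \<alpha> t - z \<beta> t\<bar> \<le> L t * norm (X (\<xi> \<alpha>) t - X (\<xi> \<beta>) t)"
        using abs_le_norm_triple(2)[of "truncated_field m a t (X (\<xi> \<alpha>) t) - truncated_field m a t (X (\<xi> \<beta>) t)"]
          lipschitz_F[OF that, of "X (\<xi> \<alpha>) t" "X (\<xi> \<beta>) t"]
        by (simp add: z_def)
      also have "\<dots> \<le> (1 + L t) * (2 * exp (2 * \<Lambda> t) * \<bar>\<alpha> - \<beta>\<bar>)"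
        using L_nonneg[OF that] by (intro mult_mono X_dep'[OF that]) auto
      finally show ?thesis by (simp add: E_def)
    qed
    show "E s \<le> E t" if "0 \<le> s" "s \<le> t" for s t
      using \<Lambda>_mono[OF that] L_nonneg[of s] L_nonneg[of t] that
      unfolding E_def by (intro mult_mono) (auto simp: L_def)
  qed
qed

section \<open>Sign analysis of a single trajectory\<close>

lemma tendsto_within: "t \<ge> 0 \<Longrightarrow> continuous_on {0..} f \<Longrightarrow> (f \<longlongrightarrow> f t) (at t within {0..})"
  for f :: "real \<Rightarrow> real"
  by (simp add: continuous_on_def)

lemma continuous_nonpos_limit:
  fixes g :: "real \<Rightarrow> real"
  assumes "continuous_on {0..} g" "\<tau> > 0" "\<And>s. 0 \<le> s \<Longrightarrow> s < \<tau> \<Longrightarrow> g s \<le> 0"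
  shows "g \<tau> \<le> 0"
proof (rule continuous_le_on_closure[where S = "{0..<\<tau>}" and f = g and x = \<tau>])
  show "continuous_on (closure {0..<\<tau>}) g"
    using assms(1,2) by (auto elim: continuous_on_subset)
qed (use assms in auto)

lemma negative_right_of:
  fixes f :: "real \<Rightarrow> real"
  assumes "\<tau> \<ge> 0" "continuous_on {0..} f" "f \<tau> < 0"
  shows "\<exists>d>0. \<forall>s. \<tau> \<le> s \<longrightarrow> s < \<tau> + d \<longrightarrow> f s < 0"
proof -
  have "\<forall>\<^sub>F s in at \<tau> within {0..}. f s < 0"
    using tendsto_within[OF assms(1,2)] assms(3) by (rule order_tendstoD)
  then obtain d where d: "d > 0" "\<And>s. s \<ge> 0 \<Longrightarrow> s \<noteq> \<tau> \<Longrightarrow> dist s \<tau> < d \<Longrightarrow> f s < 0"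
    by (auto simp: eventually_at)
  have "f s < 0" if "\<tau> \<le> s" "s < \<tau> + d" for s
    using d(2)[of s] that assms(1,3) by (cases "s = \<tau>") (auto simp: dist_real_def)
  with d(1) show ?thesis by blast
qed

locale truncated_solution =
  fixes m a :: real and x y z :: "real \<Rightarrow> real"
  assumes m: "-1 < m" "m < 0"
    and flow: "truncated_flow m a x y z"
begin

definition c :: real where "c = (m + 1) / 2"

lemma c_pos: "c > 0" and c_less_1: "c < 1"
  using m by (simp_all add: c_def)

lemma x_0: "x 0 = a" and y_0: "y 0 = - 1"
  using flow by (simp_all add: truncated_flow_def)

lemma deriv_x: "t \<ge> 0 \<Longrightarrow> (x has_real_derivative trunc 2 (y t)) (at t within {0..})"
  and deriv_y: "t \<ge> 0 \<Longrightarrow> (y has_real_derivative z t) (at t within {0..})"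
  and deriv_momentum: "t \<ge> 0 \<Longrightarrow> ((\<lambda>t. z t + c * x t * trunc 2 (y t)) has_real_derivative
        (3 * m + 1) / 2 * (trunc 2 (y t))\<^sup>2) (at t within {0..})"
  using flow unfolding truncated_flow_def c_def by blast+

lemma continuous_x: "continuous_on {0..} x"
  and continuous_y: "continuous_on {0..} y"
  using deriv_x deriv_y by (meson DERIV_continuous atLeast_iff continuous_on_eq_continuous_within)+

lemma continuous_z: "continuous_on {0..} z"
proof -
  have "continuous_on {0..} (\<lambda>t. z t + c * x t * trunc 2 (y t))"
    using deriv_momentum
    by (meson DERIV_continuous atLeast_iff continuous_on_eq_continuous_within)
  moreover have "continuous_on {0..} (\<lambda>t. c * x t * trunc 2 (y t))"
    unfolding trunc_def by (intro continuous_intros continuous_x continuous_y)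
  ultimately have "continuous_on {0..} (\<lambda>t. z t + c * x t * trunc 2 (y t) - c * x t * trunc 2 (y t))"
    by (rule continuous_on_diff)
  then show ?thesis by simp
qed

text \<open>By continuity the truncation is inactive near \<open>t\<close>, so \<open>z\<close> is
  locally the momentum minus \<open>c x y\<close>. The product rule then gives
  \<open>(c + m) y^2 - c (y^2 + x z)\<close>, which is the original equation.\<close>

lemma deriv_z:
  assumes "t \<ge> 0" "\<bar>y t\<bar> < 2"
  shows "(z has_real_derivative m * (y t)\<^sup>2 - c * x t * z t) (at t within {0..})"
proof -
  let ?g = "\<lambda>s. z s + c * x s * trunc 2 (y s) - c * (x s * y s)"
  have "((\<lambda>s. \<bar>y s\<bar>) \<longlongrightarrow> \<bar>y t\<bar>) (at t within {0..})"
    by (intro tendsto_intros tendsto_within assms continuous_y)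
  then have "\<forall>\<^sub>F s in at t within {0..}. \<bar>y s\<bar> < 2"
    using assms(2) by (rule order_tendstoD)
  then have ev: "\<forall>\<^sub>F s in at t within {0..}. z s = ?g s"
    by eventually_elim (simp add: trunc_eq)
  have y: "trunc 2 (y t) = y t"
    using assms(2) by (simp add: trunc_eq)
  have "(?g has_real_derivative
      (3 * m + 1) / 2 * (y t)\<^sup>2 - c * (y t * y t + z t * x t)) (at t within {0..})"
    using DERIV_diff[OF deriv_momentum[OF assms(1)]
      DERIV_cmult[OF DERIV_mult[OF deriv_x[OF assms(1)] deriv_y[OF assms(1)]]]]
    unfolding y .
  also have "(3 * m + 1) / 2 * (y t)\<^sup>2 - c * (y t * y t + z t * x t) = m * (y t)\<^sup>2 - c * x t * z t"
    by (simp add: c_def power2_eq_square field_simps)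
  finally show ?thesis
    using has_field_derivative_cong_eventually[OF ev] y by simp
qed

text \<open>Up to time 1 the momentum moves by at most 4, and the products
  \<open>c x trunc 2 y\<close> at times \<open>t\<close> and 0 are at most
  \<open>2 * \<bar>a\<bar> + 4\<close> and \<open>\<bar>a\<bar>\<close>. The threshold thus leaves
  \<open>z \<ge> 2\<close>, enough to lift \<open>y\<close> from -1 to at least 1.\<close>

lemma z_0_large:
  assumes "z 0 \<ge> 3 * \<bar>a\<bar> + 10"
  shows "\<And>t. t \<in> {0..1} \<Longrightarrow> z t > 0" and "y 1 > 0"
proof -
  have z: "z t \<ge> 2" if "0 \<le> t" "t \<le> 1" for t
  proof -
    have k2: "\<bar>(3 * m + 1) / 2 * (trunc 2 (y u))\<^sup>2\<bar> \<le> 4" for u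
    proof -
      have "\<bar>(3 * m + 1) / 2\<bar> * \<bar>(trunc 2 (y u))\<^sup>2\<bar> \<le> 1 * 2\<^sup>2"
        unfolding power_abs using m by (intro mult_mono power_mono abs_trunc_le) auto
      then show ?thesis by (simp add: abs_mult)
    qed
    have "\<bar>(z t + c * x t * trunc 2 (y t)) - (z 0 + c * x 0 * trunc 2 (y 0))\<bar> \<le> 4 * t"
      using abs_diff_le_of_derivative_bound[OF that(1) deriv_momentum k2] by simp
    moreover have "\<bar>x t - a\<bar> \<le> 2 * t"
      using abs_diff_le_of_derivative_bound[OF that(1) deriv_x abs_trunc_le] by (simp add: x_0)
    then have "c * (\<bar>x t\<bar> * \<bar>trunc 2 (y t)\<bar>) \<le> 1 * ((\<bar>a\<bar> + 2) * 2)"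
      using that c_pos c_less_1 by (intro mult_mono abs_trunc_le) auto
    then have "\<bar>c * x t * trunc 2 (y t)\<bar> \<le> 2 * \<bar>a\<bar> + 4"
      using c_pos by (simp add: abs_mult)
    moreover have "c * \<bar>a\<bar> \<le> 1 * \<bar>a\<bar>"
      using c_less_1 by (intro mult_right_mono) auto
    then have "\<bar>c * x 0 * trunc 2 (y 0)\<bar> \<le> \<bar>a\<bar>"
      using c_pos by (simp add: x_0 y_0 trunc_def abs_mult)
    ultimately show ?thesis using assms that by linarith
  qed
  show "z t > 0" if "t \<in> {0..1}" for t
    using z[of t] that by simp
  have "y 0 - 2 * 0 \<le> y 1 - 2 * 1"
  proof (rule has_real_derivative_nonneg_imp_le[OF order_refl zero_le_one,
        where f = "\<lambda>t. y t - 2 * t" and f' = "\<lambda>t. z t - 2"])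
    show "((\<lambda>t. y t - 2 * t) has_real_derivative z u - 2) (at u within {0..})" if "0 \<le> u" for u
      using that by (auto intro!: derivative_eq_intros deriv_y)
  qed (use z in auto)
  then show "y 1 > 0" by (simp add: y_0)
qed

lemma y_mono:
  assumes "0 \<le> s" "s \<le> t" "\<And>u. s \<le> u \<Longrightarrow> u \<le> t \<Longrightarrow> z u \<ge> 0"
  shows "y s \<le> y t"
  using assms by (intro has_real_derivative_nonneg_imp_le[OF assms(1,2) deriv_y]) auto

text \<open>This excludes a simultaneous zero of \<open>y\<close> and \<open>z\<close>. As long as
  \<open>y \<le> 0 \<le> z\<close>, the difference satisfies
  \<open>(z - y)' \<ge> - K (z - y)\<close>, and it starts at 1 or more, so Gronwall keeps it
  positive.\<close>

lemma z_greater_y: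
  assumes "\<tau> \<ge> 0" and sign: "\<And>s. 0 \<le> s \<Longrightarrow> s \<le> \<tau> \<Longrightarrow> y s \<le> 0 \<and> z s \<ge> 0"
  shows "z \<tau> > y \<tau>"
proof -
  have "bounded (x ` {0..\<tau>})"
    using continuous_on_subset[OF continuous_x, of "{0..\<tau>}"]
    by (intro compact_imp_bounded compact_continuous_image) auto
  then obtain R where "\<forall>v\<in>x ` {0..\<tau>}. norm v \<le> R"
    unfolding bounded_iff by blast
  then have R: "\<And>s. 0 \<le> s \<Longrightarrow> s \<le> \<tau> \<Longrightarrow> \<bar>x s\<bar> \<le> R"
    by simp
  \<comment> \<open>\<open>c * R\<close> dominates \<open>- c * x\<close> in the coefficient of
    \<open>z\<close>, 1 compensates \<open>- z\<close>, and \<open>- m\<close> lets the linear term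
    in \<open>y\<close> absorb \<open>m * y^2\<close>, because
    \<open>- 1 \<le> y \<le> 0\<close>.\<close>
  define K where "K = c * R + 1 - m"
  let ?h' = "\<lambda>t. (m * (y t)\<^sup>2 - c * x t * z t - z t + K * (z t - y t)) * exp (K * t)"
  have "(z 0 - y 0) * exp (K * 0) \<le> (z \<tau> - y \<tau>) * exp (K * \<tau>)"
  proof (rule has_real_derivative_nonneg_imp_le[OF order_refl \<open>\<tau> \<ge> 0\<close>,
        where f = "\<lambda>t. (z t - y t) * exp (K * t)" and f' = ?h'])
    fix u assume u: "0 \<le> u" "u \<le> \<tau>"
    have y: "- 1 \<le> y u" "y u \<le> 0" and z: "z u \<ge> 0"
      using y_mono[of 0 u] sign u y_0 by auto
    show "((\<lambda>t. (z t - y t) * exp (K * t)) has_real_derivative ?h' u) (at u within {0..})"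
      using u y by (auto intro!: derivative_eq_intros deriv_y deriv_z simp: algebra_simps)
    have "c * x u \<le> c * R"
      using R[OF u] c_pos by (intro mult_left_mono) auto
    moreover have "0 \<le> c * R"
      using R[OF u] c_pos by (intro mult_nonneg_nonneg) auto
    ultimately have "0 \<le> c * R - m - c * x u" "0 \<le> c * R + 1"
      using m by linarith+
    then have "0 \<le> (c * R - m - c * x u) * z u" "0 \<le> (c * R + 1) * (- y u)"
      "0 \<le> (- m) * ((- y u) * (1 + y u))"
      using y z m by (simp_all add: mult_nonneg_nonneg mult_nonneg_nonpos mult_nonpos_nonneg mult_nonpos_nonpos)
    then have "0 \<le> (c * R - m - c * x u) * z u + (c * R + 1) * (- y u) + (- m) * ((- y u) * (1 + y u))"
      by linarith
    also have "\<dots> = m * (y u)\<^sup>2 - c * x u * z u - z u + K * (z u - y u)"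
      by (simp add: K_def algebra_simps power2_eq_square)
    finally show "0 \<le> ?h' u" by simp
  qed
  moreover have "z 0 - y 0 > 0" using sign[of 0] y_0 \<open>\<tau> \<ge> 0\<close> by simp
  ultimately have "0 < (z \<tau> - y \<tau>) * exp (K * \<tau>)" by simp
  then show ?thesis by (simp add: zero_less_mult_iff)
qed

text \<open>The first time at which one of the strict inequalities fails can only be a time at which
  exactly one of \<open>y\<close> and \<open>z\<close> changes sign.\<close>

lemma trichotomy:
  assumes no_A: "\<not> (\<exists>t\<ge>0. z t < 0 \<and> (\<forall>s\<in>{0..t}. y s < 0))"
    and no_B: "\<not> (\<exists>t\<ge>0. y t > 0 \<and> (\<forall>s\<in>{0..t}. z s > 0))"
    and "t \<ge> 0"
  shows "y t < 0 \<and> z t > 0"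
proof (rule ccontr)
  assume contra: "\<not> (y t < 0 \<and> z t > 0)"
  \<comment> \<open>The violating times form a closed set, so the infimum \<open>\<tau>\<close> is
    itself a first violating time.\<close>
  define Bad where "Bad = ({0..} \<inter> y -` {0..}) \<union> ({0..} \<inter> z -` {..0})"
  have "closed Bad"
    unfolding Bad_def
    by (intro closed_Un continuous_closed_preimage continuous_y continuous_z closed_atLeast closed_atMost)
  moreover have "t \<in> Bad" using contra \<open>t \<ge> 0\<close> by (auto simp: Bad_def)
  moreover have bdd: "bdd_below Bad" by (rule bdd_belowI[of _ 0]) (auto simp: Bad_def)
  moreover define \<tau> where "\<tau> = Inf Bad"
  ultimately have "\<tau> \<in> Bad" using closed_contains_Inf[of Bad] by auto
  then have \<tau>: "\<tau> \<ge> 0" "y \<tau> \<ge> 0 \<or> z \<tau> \<le> 0" by (auto simp: Bad_def)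
  have before: "y s < 0" "z s > 0" if "0 \<le> s" "s < \<tau>" for s
  proof -
    have "s \<notin> Bad" using cInf_lower[OF _ bdd, of s] that by (auto simp: \<tau>_def)
    then show "y s < 0" "z s > 0" using that by (auto simp: Bad_def)
  qed
  have y_\<tau>: "y \<tau> \<le> 0"
  proof (cases "\<tau> = 0")
    case True then show ?thesis by (simp add: y_0)
  next
    case False
    then have "\<tau> > 0" using \<tau>(1) by simp
    then show ?thesis
      by (rule continuous_nonpos_limit[OF continuous_y]) (simp add: before(1) less_imp_le)
  qed
  show False
  proof (cases "y \<tau> < 0")
    case True
    obtain d where d: "d > 0" "\<And>s. \<tau> \<le> s \<Longrightarrow> s < \<tau> + d \<Longrightarrow> y s < 0"
      using negative_right_of[OF \<tau>(1) continuous_y True] by blast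
    \<comment> \<open>If \<open>z\<close> vanishes at \<open>\<tau>\<close>, its slope there is
      \<open>m * y^2 < 0\<close>, so it turns negative while \<open>y\<close> is still negative. If
      \<open>z\<close> is already negative, \<open>h = 0\<close> will do. Either way
      \<open>no_A\<close> is contradicted.\<close>
    have "\<exists>h\<ge>0. h < d \<and> z (\<tau> + h) < 0"
    proof (cases "z \<tau> = 0")
      case True
      have "y 0 \<le> y \<tau>"
      proof (rule y_mono[OF order_refl \<tau>(1)])
        show "z u \<ge> 0" if "0 \<le> u" "u \<le> \<tau>" for u
          using before(2)[of u] that True by (cases "u = \<tau>") auto
      qed
      then have "\<bar>y \<tau>\<bar> < 2" using \<open>y \<tau> < 0\<close> y_0 by simp
      then have "(z has_real_derivative m * (y \<tau>)\<^sup>2) (at \<tau> within {0..})"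
        using deriv_z[OF \<tau>(1)] True by simp
      moreover have "m * (y \<tau>)\<^sup>2 < 0"
        using m \<open>y \<tau> < 0\<close> by (simp add: mult_neg_pos)
      ultimately have "\<exists>e>0. \<forall>h>0. \<tau> + h \<in> {0..} \<longrightarrow> h < e \<longrightarrow> z \<tau> > z (\<tau> + h)"
        by (rule has_real_derivative_neg_dec_right)
      then obtain e where e: "e > 0"
        "\<And>h. h > 0 \<Longrightarrow> \<tau> + h \<in> {0..} \<Longrightarrow> h < e \<Longrightarrow> z \<tau> > z (\<tau> + h)"
        by blast
      obtain h where "0 < h" "h < min d e"
        using dense[of 0 "min d e"] d(1) e(1) by auto
      then show ?thesis
        using e(2)[of h] \<tau>(1) True by (intro exI[of _ h]) simp
    next
      case False
      then show ?thesis using \<tau> True d(1) by (intro exI[of _ 0]) auto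
    qed
    then obtain h where h: "h \<ge> 0" "h < d" "z (\<tau> + h) < 0" by blast
    have "y s < 0" if "s \<in> {0..\<tau> + h}" for s
      using that before(1)[of s] d(2)[of s] h by (cases "s < \<tau>") auto
    moreover have "\<tau> + h \<ge> 0" using h \<tau>(1) by simp
    ultimately show False using no_A h(3) by blast
  next
    case False
    then have y0: "y \<tau> = 0" using y_\<tau> by simp
    then have "\<tau> > 0" using \<tau>(1) y_0 by (cases "\<tau> = 0") auto
    have "- z \<tau> \<le> 0"
      by (rule continuous_nonpos_limit[OF continuous_on_minus[OF continuous_z] \<open>\<tau> > 0\<close>])
         (simp add: before(2) less_imp_le)
    \<comment> \<open>With \<open>y\<close> zero at \<open>\<tau>\<close> this forces
      \<open>z > 0\<close> there, so \<open>y\<close> crosses to positive values while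
      \<open>z\<close> stays positive, against \<open>no_B\<close>.\<close>
    have "y \<tau> < z \<tau>"
    proof (rule z_greater_y[OF \<tau>(1)])
      show "y s \<le> 0 \<and> z s \<ge> 0" if "0 \<le> s" "s \<le> \<tau>" for s
        using before[of s] that y_\<tau> \<open>- z \<tau> \<le> 0\<close> by (cases "s = \<tau>") auto
    qed
    then have z: "z \<tau> > 0" using y0 by simp
    have "- z \<tau> < 0" using z by simp
    obtain d where d: "d > 0" "\<And>s. \<tau> \<le> s \<Longrightarrow> s < \<tau> + d \<Longrightarrow> - z s < 0"
      using negative_right_of[OF \<tau>(1) continuous_on_minus[OF continuous_z] \<open>- z \<tau> < 0\<close>] by blast
    from has_real_derivative_pos_inc_right[OF deriv_y[OF \<tau>(1)] z]
    obtain e where e: "e > 0" "\<And>h. h > 0 \<Longrightarrow> \<tau> + h \<in> {0..} \<Longrightarrow> h < e \<Longrightarrow> y \<tau> < y (\<tau> + h)"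
      by blast
    obtain h where h: "h > 0" "h < d" "h < e"
      using dense[of 0 "min d e"] d(1) e(1) by auto
    have "y (\<tau> + h) > 0" using e(2)[of h] h \<tau>(1) y0 by simp
    moreover have "z s > 0" if "s \<in> {0..\<tau> + h}" for s
      using that before(2)[of s] d(2)[of s] h by (cases "s < \<tau>") auto
    moreover have "\<tau> + h \<ge> 0" using h \<tau>(1) by simp
    ultimately show False using no_B by blast
  qed
qed

section \<open>Convergence and convexity for a trajectory that stays in
  \<open>y < 0 < z\<close>\<close>

context
  assumes y_neg: "\<And>t. t \<ge> 0 \<Longrightarrow> y t < 0" and z_pos: "\<And>t. t \<ge> 0 \<Longrightarrow> z t > 0"
begin

lemma y_mono': "0 \<le> s \<Longrightarrow> s \<le> t \<Longrightarrow> y s \<le> y t"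
  by (rule y_mono) (use z_pos in \<open>auto intro: less_imp_le\<close>)

lemma y_ge: "0 \<le> t \<Longrightarrow> - 1 \<le> y t"
  using y_mono'[of 0 t] y_0 by simp

lemma deriv_x': "t \<ge> 0 \<Longrightarrow> (x has_real_derivative y t) (at t within {0..})"
  using deriv_x[of t] y_neg[of t] y_ge[of t] by (simp add: trunc_eq)

lemma deriv_z': "t \<ge> 0 \<Longrightarrow> (z has_real_derivative m * (y t)\<^sup>2 - c * x t * z t) (at t within {0..})"
  using deriv_z[of t] y_neg[of t] y_ge[of t] by simp

text \<open>If \<open>y\<close> had a limit \<open>l < 0\<close>, then \<open>z + c x (y - l)\<close>, which is eventually nonnegative because
  \<open>x\<close> tends to \<open>-\<infinity>\<close>, would have the derivative \<open>m y\<^sup>2 + c y (y - l)\<close>, which tends to \<open>m l\<^sup>2 < 0\<close>.\<close>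

lemma y_tendsto_0: "(y \<longlongrightarrow> 0) at_top"
proof -
  define l where "l = Sup (y ` {0..})"
  have bdd: "bdd_above (y ` {0..})"
    using y_neg by (auto intro!: bdd_aboveI[of _ 0] less_imp_le)
  have y_le: "y t \<le> l" if "t \<ge> 0" for t
    unfolding l_def using that bdd by (intro cSup_upper) auto
  have l_le: "l \<le> 0"
    unfolding l_def using y_neg by (intro cSup_least) (auto intro: less_imp_le)
  have lim: "(y \<longlongrightarrow> l) at_top"
  proof (rule increasing_tendsto)
    show "\<forall>\<^sub>F t in at_top. y t \<le> l"
      using eventually_ge_at_top[of 0] by eventually_elim (rule y_le)
    fix v assume "v < l"
    then obtain s where "s \<ge> 0" "v < y s"
      using less_cSup_iff[OF _ bdd] by (auto simp: l_def)
    then show "\<forall>\<^sub>F t in at_top. v < y t"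
      by (intro eventually_mono[OF eventually_ge_at_top[of s]]) (rule less_le_trans[OF _ y_mono'])
  qed
  have "l = 0"
  proof (rule ccontr)
    assume "l \<noteq> 0"
    then have l: "l < 0" using l_le by simp
    \<comment> \<open>Since \<open>y \<le> l < 0\<close>, one has
      \<open>m * y^2 \<le> - 2 * k\<close>; once \<open>y > l - k\<close>, the term
      \<open>c * y * (y - l)\<close> is at most \<open>k\<close>. Hence
      \<open>v' \<le> - k\<close>.\<close>
    define k where "k = - (m * l\<^sup>2) / 2"
    have k: "k > 0" using m l by (simp add: k_def mult_neg_pos)
    have "\<forall>\<^sub>F t in at_top. l - k < y t"
      using lim k by (intro order_tendstoD) auto
    then obtain T\<^sub>1 where T\<^sub>1: "\<And>t. t \<ge> T\<^sub>1 \<Longrightarrow> l - k < y t"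
      by (auto simp: eventually_at_top_linorder)
    \<comment> \<open>Integrating \<open>y \<le> l\<close> gives \<open>x t \<le> a + l * t\<close>,
      which is nonpositive from \<open>\<bar>a\<bar> / - l\<close> on.\<close>
    define T where "T = max (max 0 T\<^sub>1) (\<bar>a\<bar> / - l)"
    have T: "T \<ge> 0" "T \<ge> T\<^sub>1" "\<bar>a\<bar> / - l \<le> T" by (simp_all add: T_def)
    define v where "v t = z t + c * x t * (y t - l)" for t
    have v_nonneg: "v t \<ge> 0" if "t \<ge> T" for t
    proof -
      have t: "t \<ge> 0" using that T by simp
      have "l * 0 - x 0 \<le> l * t - x t"
      proof (rule has_real_derivative_nonneg_imp_le[OF order_refl t,
            where f = "\<lambda>s. l * s - x s" and f' = "\<lambda>s. l - y s"])
        show "((\<lambda>s. l * s - x s) has_real_derivative l - y u) (at u within {0..})" if "0 \<le> u" for u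
          using that by (auto intro!: derivative_eq_intros deriv_x')
      qed (use y_le in auto)
      moreover have "\<bar>a\<bar> / - l \<le> t" using T that by simp
      then have "\<bar>a\<bar> \<le> t * - l" using l by (subst (asm) pos_divide_le_eq) auto
      ultimately have "x t \<le> 0" by (simp add: x_0 algebra_simps)
      then have "0 \<le> c * (x t * (y t - l))"
        using y_le[OF t] c_pos by (intro mult_nonneg_nonneg mult_nonpos_nonpos) auto
      then show ?thesis using z_pos[OF t] by (simp add: v_def mult.assoc)
    qed
    \<comment> \<open>Decreasing at rate at least \<open>k\<close>, \<open>v\<close> would have
      fallen to -1 or below by time \<open>S\<close>.\<close>
    define S where "S = T + (v T + 1) / k"
    have S: "S \<ge> T" using v_nonneg[of T] k by (simp add: S_def)
    have "- v T - k * T \<le> - v S - k * S"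
    proof (rule has_real_derivative_nonneg_imp_le[OF T(1) S,
          where f = "\<lambda>s. - v s - k * s" and f' = "\<lambda>s. - (m * (y s)\<^sup>2 + c * (y s * (y s - l))) - k"])
      fix u assume "T \<le> u"
      then have u: "u \<ge> 0" "u \<ge> T\<^sub>1" using T by auto
      show "((\<lambda>s. - v s - k * s) has_real_derivative
          - (m * (y u)\<^sup>2 + c * (y u * (y u - l))) - k) (at u within {0..})"
        unfolding v_def using u
        by (auto intro!: derivative_eq_intros deriv_x' deriv_y deriv_z'
            simp: algebra_simps power2_eq_square)
      have "(- l)\<^sup>2 \<le> (- y u)\<^sup>2"
        using y_le[OF u(1)] l by (intro power_mono) auto
      then have "m * (y u)\<^sup>2 \<le> - 2 * k" using m by (simp add: k_def)
      moreover have "c * ((- y u) * (l - y u)) \<le> 1 * (1 * k)"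
        using y_ge[OF u(1)] y_le[OF u(1)] y_neg[OF u(1)] T\<^sub>1[OF u(2)] c_less_1
        by (intro mult_mono mult_nonneg_nonneg) linarith+
      ultimately show "0 \<le> - (m * (y u)\<^sup>2 + c * (y u * (y u - l))) - k"
        by (simp add: algebra_simps)
    qed
    moreover have "k * S = k * T + v T + 1"
      using k by (simp add: S_def field_simps)
    ultimately show False using v_nonneg[OF S] by linarith
  qed
  with lim show ?thesis by simp
qed

lemma convex_bvp_solution_x: "convex_bvp_solution m a (- 1) x"
proof -
  have "bvp_solution m a (- 1) x"
    unfolding bvp_solution_def
    using deriv_x' deriv_y deriv_z' x_0 y_0 y_tendsto_0
    by (intro exI[of _ y] exI[of _ z] exI[of _ "\<lambda>t. m * (y t)\<^sup>2 - c * x t * z t"])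
       (simp add: c_def)
  moreover have "convex_on {0..} x"
    using deriv_x' y_mono' by (rule convex_on_nondecreasing_derivative)
  ultimately show ?thesis by (simp add: convex_bvp_solution_def)
qed

end

end

section \<open>Shooting\<close>

text \<open>On the compact interval the strict inequalities hold with a margin
  \<open>\<epsilon>\<close>, and monotonicity of \<open>E\<close> makes the perturbation bound
  uniform there. The lemma is used with \<open>(- z, - y)\<close> and with
  \<open>(y, z)\<close>.\<close>

lemma open_shooting_set:
  fixes u v :: "real \<Rightarrow> real \<Rightarrow> real" and E :: "real \<Rightarrow> real"
  assumes u: "\<And>\<alpha> \<beta> t. t \<ge> 0 \<Longrightarrow> \<bar>u \<alpha> t - u \<beta> t\<bar> \<le> E t * \<bar>\<alpha> - \<beta>\<bar>"
    and v: "\<And>\<alpha> \<beta> t. t \<ge> 0 \<Longrightarrow> \<bar>v \<alpha> t - v \<beta> t\<bar> \<le> E t * \<bar>\<alpha> - \<beta>\<bar>"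
    and E: "\<And>s t. 0 \<le> s \<Longrightarrow> s \<le> t \<Longrightarrow> E s \<le> E t"
    and cont: "\<And>\<alpha>. continuous_on {0..} (v \<alpha>)"
  shows "open {\<alpha>. \<exists>t\<ge>0. 0 < u \<alpha> t \<and> (\<forall>s\<in>{0..t}. 0 < v \<alpha> s)}"
proof (rule openI)
  fix \<alpha> assume "\<alpha> \<in> {\<alpha>. \<exists>t\<ge>0. 0 < u \<alpha> t \<and> (\<forall>s\<in>{0..t}. 0 < v \<alpha> s)}"
  then obtain t where t: "t \<ge> 0" "0 < u \<alpha> t" "\<And>s. s \<in> {0..t} \<Longrightarrow> 0 < v \<alpha> s" by blast
  obtain s\<^sub>0 where s\<^sub>0: "s\<^sub>0 \<in> {0..t}" "\<And>s. s \<in> {0..t} \<Longrightarrow> v \<alpha> s\<^sub>0 \<le> v \<alpha> s"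
    using continuous_attains_inf[of "{0..t}" "v \<alpha>"] t(1) continuous_on_subset[OF cont, of "{0..t}" \<alpha>]
    by auto
  define \<epsilon> where "\<epsilon> = min (u \<alpha> t) (v \<alpha> s\<^sub>0)"
  have \<epsilon>: "\<epsilon> > 0" "\<epsilon> \<le> u \<alpha> t" "\<And>s. s \<in> {0..t} \<Longrightarrow> \<epsilon> \<le> v \<alpha> s"
    using t(2,3) s\<^sub>0 by (auto simp: \<epsilon>_def min.coboundedI2)
  have Et: "E t \<ge> 0" using u[OF t(1), of 1 0] by simp
  \<comment> \<open>The \<open>+ 1\<close> keeps the radius meaningful when
    \<open>E t = 0\<close>.\<close>
  have "ball \<alpha> (\<epsilon> / (E t + 1)) \<subseteq> {\<alpha>. \<exists>t\<ge>0. 0 < u \<alpha> t \<and> (\<forall>s\<in>{0..t}. 0 < v \<alpha> s)}"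
  proof
    fix \<beta> assume "\<beta> \<in> ball \<alpha> (\<epsilon> / (E t + 1))"
    then have "(E t + 1) * \<bar>\<alpha> - \<beta>\<bar> < \<epsilon>"
      using Et by (simp add: dist_real_def field_simps)
    then have d: "E t * \<bar>\<alpha> - \<beta>\<bar> < \<epsilon>" by (simp add: algebra_simps)
    have "u \<beta> t > 0" using u[OF t(1), of \<alpha> \<beta>] d \<epsilon>(2) by linarith
    moreover have "v \<beta> s > 0" if s: "s \<in> {0..t}" for s
    proof -
      have "E s * \<bar>\<alpha> - \<beta>\<bar> \<le> E t * \<bar>\<alpha> - \<beta>\<bar>"
        using E s by (intro mult_right_mono) auto
      then show ?thesis using v[of s \<alpha> \<beta>] d \<epsilon>(3)[OF s] s by simp
    qed
    ultimately show "\<beta> \<in> {\<alpha>. \<exists>t\<ge>0. 0 < u \<alpha> t \<and> (\<forall>s\<in>{0..t}. 0 < v \<alpha> s)}"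
      using t(1) by blast
  qed
  moreover have "\<epsilon> / (E t + 1) > 0" using \<epsilon>(1) Et by simp
  ultimately show "\<exists>e>0. ball \<alpha> e \<subseteq> {\<alpha>. \<exists>t\<ge>0. 0 < u \<alpha> t \<and> (\<forall>s\<in>{0..t}. 0 < v \<alpha> s)}"
    by blast
qed

theorem theorem3:
  fixes m a :: real
  assumes "-1 < m" and "m < 0"
  shows "\<exists>f. convex_bvp_solution m a (-1) f"
proof -
  obtain x y z :: "real \<Rightarrow> real \<Rightarrow> real" and E :: "real \<Rightarrow> real"
    where flow: "\<And>\<alpha>. truncated_flow m a (x \<alpha>) (y \<alpha>) (z \<alpha>)" and z_0: "\<And>\<alpha>. z \<alpha> 0 = \<alpha>"
    and y_dep: "\<And>\<alpha> \<beta> t. t \<ge> 0 \<Longrightarrow> \<bar>y \<alpha> t - y \<beta> t\<bar> \<le> E t * \<bar>\<alpha> - \<beta>\<bar>"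
    and z_dep: "\<And>\<alpha> \<beta> t. t \<ge> 0 \<Longrightarrow> \<bar>z \<alpha> t - z \<beta> t\<bar> \<le> E t * \<bar>\<alpha> - \<beta>\<bar>"
    and E: "\<And>s t. 0 \<le> s \<Longrightarrow> s \<le> t \<Longrightarrow> E s \<le> E t"
    using truncated_flow_family[OF assms] by blast
  have sol: "truncated_solution m a (x \<alpha>) (y \<alpha>) (z \<alpha>)" for \<alpha>
    using assms flow by unfold_locales
  define A where "A = {\<alpha>. \<exists>t\<ge>0. 0 < - z \<alpha> t \<and> (\<forall>s\<in>{0..t}. 0 < - y \<alpha> s)}"
  define B where "B = {\<alpha>. \<exists>t\<ge>0. 0 < y \<alpha> t \<and> (\<forall>s\<in>{0..t}. 0 < z \<alpha> s)}"
  have "open A"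
    unfolding A_def using y_dep z_dep truncated_solution.continuous_y[OF sol]
    by (intro open_shooting_set[where E = E] E continuous_on_minus)
       (simp_all add: abs_minus_commute)
  moreover have "open B"
    unfolding B_def using truncated_solution.continuous_z[OF sol]
    by (intro open_shooting_set[where E = E] E y_dep z_dep)
  moreover have "A \<inter> B \<inter> UNIV = {}"
  proof (rule ccontr)
    assume "A \<inter> B \<inter> UNIV \<noteq> {}"
    then obtain \<alpha> s t where "s \<ge> 0" "z \<alpha> s < 0" "\<forall>r\<in>{0..s}. y \<alpha> r < 0"
      and "t \<ge> 0" "y \<alpha> t > 0" "\<forall>r\<in>{0..t}. z \<alpha> r > 0"
      by (auto simp: A_def B_def)
    \<comment> \<open>Whichever of the two times came first would lie in the interval on which the
      other condition fixes the opposite sign.\<close>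
    then have "\<not> s \<le> t" and "\<not> t \<le> s"
      by (meson atLeastAtMost_iff less_asym)+
    then show False by simp
  qed
  moreover have "A \<noteq> {}"
  proof -
    \<comment> \<open>Time 0 is a witness: \<open>y\<close> and \<open>z\<close> both start at
      -1.\<close>
    have "- 1 \<in> A"
      unfolding A_def using z_0[of "- 1"] truncated_solution.y_0[OF sol, of "- 1"]
      by (auto intro!: exI[of _ 0])
    then show ?thesis by blast
  qed
  moreover have "B \<noteq> {}"
  proof -
    have "3 * \<bar>a\<bar> + 10 \<in> B"
      unfolding B_def using truncated_solution.z_0_large[OF sol] z_0
      by (auto intro!: exI[of _ 1])
    then show ?thesis by blast
  qed
  ultimately have "\<not> UNIV \<subseteq> A \<union> B"
    using connectedD[OF connected_UNIV, of A B] by blast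
  then obtain \<alpha> where \<alpha>: "\<alpha> \<notin> A" "\<alpha> \<notin> B" by blast
  then have "y \<alpha> t < 0 \<and> z \<alpha> t > 0" if "t \<ge> 0" for t
    using that by (intro truncated_solution.trichotomy[OF sol]) (auto simp: A_def B_def)
  then have "convex_bvp_solution m a (- 1) (x \<alpha>)"
    by (intro truncated_solution.convex_bvp_solution_x[OF sol]) auto
  then show ?thesis by blast
qed

end
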